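(* Let $n,a,x$ be positive integers with $x\ge 2$ such that $M=\langle na,\,na+n,\,2na+nx+1\rangle$ is a numerical monoid of embedding dimension three. Then $c_{mon}(M)>c(M)$.
   Context: $\mathbb N$ includes $0$. A numerical monoid is a cofinite additive submonoid of $\mathbb N$; it has a unique minimal generating set, whose cardinality is the embedding dimension. Here $M=\langle n_1,n_2,n_3\rangle$ has embedding dimension three, i.e. the three listed generators are the minimal generators. For $m\in M$: $\mathcal Z(m)=\{(z_1,z_2,z_3)\in\mathbb N^3 : z_1n_1+z_2n_2+z_3n_3=m\}$ (factorizations); the length is $|z|=z_1+z_2+z_3$. For $z,z'\in\mathcal Z(m)$, $\gcd\{z,z'\}$ is the coordinatewise minimum and $d(z,z')=\max\{|z|,|z'|\}-|\gcd\{z,z'\}|$. An $N$-chain from $z$ to $z'$ is a finite sequence of factorizations of $m$ starting at $z$ and ending at $z'$ with consecutive distances $\le N$. $c(m)$ is the smallest $N\in\mathbb N$ such that any two factorizations of $m$ are connected by an $N$-chain. $c_{mon}(m)$ is the smallest $N\in\mathbb N$ such that any two factorizations of $m$ are connected by an $N$-chain along which the lengths are either non-decreasing throughout or non-increasing throughout. $c(M)=\max\{c(m):m\in M\}$ and $c_{mon}(M)=\max\{c_{mon}(m):m\in M\}$. *)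

theory Defs
  imports Complex_Main
begin

definition submonoid :: "nat set \<Rightarrow> bool" where
  "submonoid M \<longleftrightarrow> 0 \<in> M \<and> (\<forall>u\<in>M. \<forall>v\<in>M. u + v \<in> M)"

definition generated :: "nat set \<Rightarrow> nat set" where
  "generated A = submonoid hull A"

definition numerical_monoid :: "nat set \<Rightarrow> bool" where
  "numerical_monoid M \<longleftrightarrow> submonoid M \<and> finite (- M)"

definition minimal_generating_set :: "nat set \<Rightarrow> nat set \<Rightarrow> bool" where
  "minimal_generating_set M A \<longleftrightarrow>
     generated A = M \<and> (\<forall>B. B \<subset> A \<longrightarrow> generated B \<noteq> M)"

text \<open>Every submonoid of the naturals has exactly one minimal generating set, so the
  description below denotes.\<close>

definition embedding_dimension :: "nat set \<Rightarrow> nat" where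
  "embedding_dimension M = card (THE A. minimal_generating_set M A)"

text \<open>The catenary invariants below take the triple of generators as their argument, since
  factorizations are coordinate vectors over it. They are the invariants of the generated monoid
  when the entries of the triple are its three minimal generators.\<close>

type_synonym triple = "nat \<times> nat \<times> nat"

fun gens :: "triple \<Rightarrow> nat set" where
  "gens (n1, n2, n3) = {n1, n2, n3}"

fun weight :: "triple \<Rightarrow> triple \<Rightarrow> nat" where
  "weight (n1, n2, n3) (z1, z2, z3) = z1 * n1 + z2 * n2 + z3 * n3"

definition factorizations :: "triple \<Rightarrow> nat \<Rightarrow> triple set" where
  "factorizations g m = {z. weight g z = m}"

fun len :: "triple \<Rightarrow> nat" where
  "len (z1, z2, z3) = z1 + z2 + z3"

fun fgcd :: "triple \<Rightarrow> triple \<Rightarrow> triple" where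
  "fgcd (z1, z2, z3) (w1, w2, w3) = (min z1 w1, min z2 w2, min z3 w3)"

text \<open>The truncated subtraction is exact, as \<open>len (fgcd z w) \<le> len z\<close>.\<close>

definition fdist :: "triple \<Rightarrow> triple \<Rightarrow> nat" where
  "fdist z w = max (len z) (len w) - len (fgcd z w)"

definition is_chain :: "triple \<Rightarrow> nat \<Rightarrow> nat \<Rightarrow> triple \<Rightarrow> triple \<Rightarrow> triple list \<Rightarrow> bool" where
  "is_chain g m N z w zs \<longleftrightarrow>
     zs \<noteq> [] \<and> hd zs = z \<and> last zs = w \<and> set zs \<subseteq> factorizations g m \<and>
     successively (\<lambda>u v. fdist u v \<le> N) zs"

definition is_monotone_chain ::
  "triple \<Rightarrow> nat \<Rightarrow> nat \<Rightarrow> triple \<Rightarrow> triple \<Rightarrow> triple list \<Rightarrow> bool" where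
  "is_monotone_chain g m N z w zs \<longleftrightarrow>
     is_chain g m N z w zs \<and>
     (sorted_wrt (\<le>) (map len zs) \<or> sorted_wrt (\<ge>) (map len zs))"

definition catenary_degree_of :: "triple \<Rightarrow> nat \<Rightarrow> nat" where
  "catenary_degree_of g m =
     (LEAST N. \<forall>z\<in>factorizations g m. \<forall>w\<in>factorizations g m. \<exists>zs. is_chain g m N z w zs)"

definition monotone_catenary_degree_of :: "triple \<Rightarrow> nat \<Rightarrow> nat" where
  "monotone_catenary_degree_of g m =
     (LEAST N. \<forall>z\<in>factorizations g m. \<forall>w\<in>factorizations g m. \<exists>zs. is_monotone_chain g m N z w zs)"

text \<open>For positive generators both maxima below exist: the two sets of degrees are finite,
  although the monoid is infinite.\<close>

definition catenary_degree :: "triple \<Rightarrow> nat" where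
  "catenary_degree g = Max {catenary_degree_of g m | m. m \<in> generated (gens g)}"

definition monotone_catenary_degree :: "triple \<Rightarrow> nat" where
  "monotone_catenary_degree g = Max {monotone_catenary_degree_of g m | m. m \<in> generated (gens g)}"

end

theory Submission
  imports Defs "HOL-Library.Product_Plus"
begin

text \<open>
  Two factorizations of the same element differ by a vector of the lattice of integer relations
  between the generators. Here that lattice has the basis \<open>(a + 1, - a, 0)\<close> and
  \<open>(n x + 1 - 2 n, - (n x + 1), n)\<close>, whose coordinate sums are \<open>1\<close> and \<open>- n\<close>. Hence the relations
  that preserve the length are exactly the multiples of
  \<open>(n a + n x + 1 - n, - (n a + n x + 1), n)\<close>.

  This makes the monotone catenary degree large. The two sides of the last vector are factorizations
  of equal length, so a monotone chain between them has constant length, and each nontrivial step of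
  such a chain changes the second coordinate by a nonzero multiple of \<open>n a + n x + 1\<close>
  (\<open>fdist_same_length\<close>).

  Chains whose lengths may vary are cheaper: steps of size \<open>K = n a + n x\<close> always suffice
  (\<open>linked_connected\<close>). The short relation \<open>(a + 1, - a, 0)\<close> brings the first coordinates of both
  factorizations down to at most \<open>a\<close>. After that, the gap between the third coordinates shrinks
  by \<open>n\<close> whenever one of the relations \<open>(n x + 1 - 2 n - i (a + 1), - (n x + 1) + i a, n)\<close> can be
  added to the one factorization or subtracted from the other. If no \<open>i\<close> allows this, then the
  first two coordinates of both are confined to so small a box that the two factorizations are
  themselves at distance at most \<open>K\<close> (\<open>linked_stuck\<close>).

  The monotone catenary degree of the monoid is a maximum over infinitely many elements, and the
  lower bound for one element says something about it only once the degrees are known to be bounded.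
  This holds for every triple of generators: by Dickson's lemma the pairs of equally heavy
  factorizations with non-decreasing length are sums of pairs from a finite set of irreducible ones,
  and a pair is joined by a monotone chain that exchanges one summand after the other
  (\<open>ascents_linked_up\<close>).
\<close>

section \<open>Distances and chains\<close>

text \<open>Since \<open>z - min z w\<close> is the truncated difference \<open>z - w\<close>, the distance depends on the difference
  of the factorizations only.\<close>

lemma fdist_eq:
  "fdist (z1, z2, z3) (w1, w2, w3) =
     max ((z1 - w1) + (z2 - w2) + (z3 - w3)) ((w1 - z1) + (w2 - z2) + (w3 - z3))"
  by (auto simp: fdist_def max_def min_def)

lemma fdist_commute: "fdist z w = fdist w z"
  by (cases z; cases w) (simp add: fdist_eq max.commute)

lemma fdist_translate: "fdist (z + c) (w + c) = fdist z w"
  by (cases z; cases w; cases c) (simp add: fdist_eq)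

lemma fdist_le_len: "fdist z w \<le> max (len z) (len w)"
  by (simp add: fdist_def)

lemma weight_add: "weight g (z + w) = weight g z + weight g w"
  by (cases g; cases z; cases w) (simp add: algebra_simps)

lemma len_add: "len (z + w) = len z + len w"
  by (cases z; cases w) simp

lemma len_eq_0_iff: "len z = 0 \<longleftrightarrow> z = 0"
  by (cases z) (auto simp: zero_prod_def)

text \<open>Chains are handled as paths of a relation on factorizations, so that they can be composed,
  reversed and translated without manipulating lists.\<close>

definition linked :: "triple \<Rightarrow> nat \<Rightarrow> triple \<Rightarrow> triple \<Rightarrow> bool" where
  "linked g N z w \<longleftrightarrow> weight g z = weight g w \<and> fdist z w \<le> N"

definition linked_up :: "triple \<Rightarrow> nat \<Rightarrow> triple \<Rightarrow> triple \<Rightarrow> bool" where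
  "linked_up g N z w \<longleftrightarrow> linked g N z w \<and> len z \<le> len w"

lemma linked_commute: "linked g N z w \<longleftrightarrow> linked g N w z"
  by (auto simp: linked_def fdist_commute)

lemma rtranclp_imp_list:
  assumes "R\<^sup>*\<^sup>* z w"
  shows "\<exists>zs. zs \<noteq> [] \<and> hd zs = z \<and> last zs = w \<and> successively R zs"
  using assms
proof (induction rule: converse_rtranclp_induct)
  case base
  show ?case by (rule exI[of _ "[w]"]) simp
next
  case (step y z)
  then obtain zs where "zs \<noteq> []" "hd zs = z" "last zs = w" "successively R zs" by blast
  with step(1) show ?case by (intro exI[of _ "y # zs"]) (simp add: successively_Cons)
qed

lemma successively_linked_subset:
  assumes "zs \<noteq> []" "successively (linked g N) zs"
  shows "set zs \<subseteq> factorizations g (weight g (hd zs))"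
  using assms
  by (induction zs rule: induct_list012) (auto simp: factorizations_def linked_def)

lemma chain_of_linked:
  assumes "(linked g N)\<^sup>*\<^sup>* z w" "z \<in> factorizations g m"
  shows "\<exists>zs. is_chain g m N z w zs"
proof -
  obtain zs where zs: "zs \<noteq> []" "hd zs = z" "last zs = w" "successively (linked g N) zs"
    using rtranclp_imp_list[OF assms(1)] by blast
  have "set zs \<subseteq> factorizations g m"
    using successively_linked_subset[OF zs(1,4)] zs(2) assms(2) by (auto simp: factorizations_def)
  moreover have "successively (\<lambda>u v. fdist u v \<le> N) zs"
    using zs(4) by (rule successively_mono) (simp_all add: linked_def)
  ultimately show ?thesis using zs unfolding is_chain_def by blast
qed

lemma is_chain_rev: "is_chain g m N z w zs \<Longrightarrow> is_chain g m N w z (rev zs)"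
  by (auto simp: is_chain_def hd_rev last_rev fdist_commute)

lemma monotone_chain_of_linked_up:
  assumes "(linked_up g N)\<^sup>*\<^sup>* z w" "z \<in> factorizations g m"
  shows "\<exists>zs. is_chain g m N z w zs \<and> sorted_wrt (\<le>) (map len zs)"
proof -
  obtain zs where zs: "zs \<noteq> []" "hd zs = z" "last zs = w" "successively (linked_up g N) zs"
    using rtranclp_imp_list[OF assms(1)] by blast
  have lk: "successively (linked g N) zs"
    using zs(4) by (rule successively_mono) (simp_all add: linked_up_def)
  have "set zs \<subseteq> factorizations g m"
    using successively_linked_subset[OF zs(1) lk] zs(2) assms(2) by (auto simp: factorizations_def)
  moreover have "successively (\<lambda>u v. fdist u v \<le> N) zs"
    using lk by (rule successively_mono) (simp_all add: linked_def)
  moreover have "successively (\<lambda>u v. len u \<le> len v) zs"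
    using zs(4) by (rule successively_mono) (simp_all add: linked_up_def)
  then have "sorted_wrt (\<le>) (map len zs)"
    unfolding sorted_wrt_map
    by (subst successively_iff_sorted_wrt_strong[symmetric]) (auto intro: order_trans)
  ultimately show ?thesis using zs unfolding is_chain_def by blast
qed

section \<open>Monotone catenary degrees are bounded\<close>

text \<open>A monotone subsequence exists in any linear order; if it decreases, then it is constant from
  its minimum on, because the naturals are well-founded.\<close>

lemma incseq_subseq_nat:
  fixes f :: "nat \<Rightarrow> nat"
  shows "\<exists>r. strict_mono r \<and> incseq (\<lambda>n. f (r n))"
proof -
  obtain r where r: "strict_mono r" "monoseq (\<lambda>n. f (r n))"
    using seq_monosub by blast
  show ?thesis
  proof (cases "incseq (\<lambda>n. f (r n))")
    case False
    then have dec: "decseq (\<lambda>n. f (r n))" using r(2) by (simp add: monoseq_iff)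
    define k where "k = (ARG_MIN (\<lambda>n. f (r n)) n. True)"
    have k: "f (r k) \<le> f (r n)" for n
      using arg_min_nat_le[of "\<lambda>_. True" n "\<lambda>n. f (r n)"] by (simp add: k_def)
    have "f (r (k + n)) = f (r k)" for n
      using k[of "k + n"] decseqD[OF dec, of k "k + n"] by simp
    then have "incseq (\<lambda>n. f (r (k + n)))" by (simp add: incseq_def)
    moreover have "strict_mono (\<lambda>n. r (k + n))" using r(1) by (simp add: strict_mono_def)
    ultimately show ?thesis by blast
  qed (use r in blast)
qed

lemma incseq_subseq_nat_family:
  fixes F :: "(nat \<Rightarrow> nat) set"
  assumes "finite F"
  shows "\<exists>r. strict_mono r \<and> (\<forall>f\<in>F. incseq (\<lambda>n. f (r n)))"
  using assms
proof induction
  case empty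
  show ?case by (auto intro: exI[of _ id] simp: strict_mono_def)
next
  case (insert f F)
  then obtain r where r: "strict_mono r" "\<forall>f\<in>F. incseq (\<lambda>n. f (r n))" by blast
  obtain s where s: "strict_mono s" "incseq (\<lambda>n. f (r (s n)))"
    using incseq_subseq_nat[of "\<lambda>n. f (r n)"] by blast
  have "incseq (\<lambda>n. h (r (s n)))" if "h \<in> F" for h
    using r(2) that s(1) by (auto simp: incseq_def strict_mono_less_eq)
  with s r(1) show ?case
    by (intro exI[of _ "\<lambda>n. r (s n)"]) (auto simp: strict_mono_def)
qed

text \<open>An infinite set contains an injective sequence, and some subsequence of it increases in
  all the finitely many coordinates \<open>F\<close> at once.\<close>

lemma Dickson:
  fixes F :: "('a \<Rightarrow> nat) set"
  assumes "finite F" "infinite A"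
  shows "\<exists>u\<in>A. \<exists>v\<in>A. u \<noteq> v \<and> (\<forall>f\<in>F. f u \<le> f v)"
proof -
  obtain s :: "nat \<Rightarrow> 'a" where s: "inj s" "range s \<subseteq> A"
    using infinite_countable_subset[OF assms(2)] by blast
  obtain r where r: "strict_mono r" "\<forall>f\<in>(\<lambda>f. f \<circ> s) ` F. incseq (\<lambda>n. f (r n))"
    using incseq_subseq_nat_family[of "(\<lambda>f. f \<circ> s) ` F"] assms(1) by blast
  have "f (s (r 0)) \<le> f (s (r 1))" if "f \<in> F" for f
    using r(2) that by (auto simp: incseq_def)
  moreover have "s (r 0) \<noteq> s (r 1)"
    using s(1) r(1) by (simp add: inj_eq strict_mono_eq)
  ultimately show ?thesis using s(2) by blast
qed

text \<open>The pairs that a chain of non-decreasing length may have to connect. They form a monoid under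
  componentwise addition.\<close>

definition ascents :: "triple \<Rightarrow> (triple \<times> triple) set" where
  "ascents g = {(z, w). weight g z = weight g w \<and> len z \<le> len w}"

definition irreducible_ascents :: "triple \<Rightarrow> (triple \<times> triple) set" where
  "irreducible_ascents g =
     {p \<in> ascents g. \<nexists>q r. q \<in> ascents g \<and> r \<in> ascents g \<and> q \<noteq> 0 \<and> r \<noteq> 0 \<and> p = q + r}"

text \<open>An irreducible ascent cannot lie above another one, for the difference would be the missing
  summand. For the difference to be an ascent again, the surplus length of the larger pair must be
  at least that of the smaller one, so the surplus is a seventh coordinate of the comparison.\<close>

lemma finite_irreducible_ascents: "finite (irreducible_ascents g)"
proof (rule ccontr)
  assume "infinite (irreducible_ascents g)"
  then have inf: "infinite (irreducible_ascents g - {0})" by simp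
  define F :: "(triple \<times> triple \<Rightarrow> nat) set" where
    "F = {\<lambda>p. fst (fst p), \<lambda>p. fst (snd (fst p)), \<lambda>p. snd (snd (fst p)),
          \<lambda>p. fst (snd p), \<lambda>p. fst (snd (snd p)), \<lambda>p. snd (snd (snd p)),
          \<lambda>p. len (snd p) - len (fst p)}"
  have "finite F" by (simp add: F_def)
  from Dickson[OF this inf] obtain q p where
    q: "q \<in> irreducible_ascents g" "q \<noteq> 0" and p: "p \<in> irreducible_ascents g" and
    ne: "q \<noteq> p" and le: "\<forall>f\<in>F. f q \<le> f p" by blast
  have qA: "q \<in> ascents g" and pA: "p \<in> ascents g" using q p by (auto simp: irreducible_ascents_def)
  obtain a1 a2 a3 b1 b2 b3 where qq: "q = ((a1, a2, a3), (b1, b2, b3))" by (metis prod.exhaust)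
  obtain c1 c2 c3 d1 d2 d3 where pp: "p = ((c1, c2, c3), (d1, d2, d3))" by (metis prod.exhaust)
  have le': "a1 \<le> c1" "a2 \<le> c2" "a3 \<le> c3" "b1 \<le> d1" "b2 \<le> d2" "b3 \<le> d3"
    "(b1 + b2 + b3) - (a1 + a2 + a3) \<le> (d1 + d2 + d3) - (c1 + c2 + c3)"
    using le by (auto simp: F_def qq pp)
  define z w where "z = (c1 - a1, c2 - a2, c3 - a3)" and "w = (d1 - b1, d2 - b2, d3 - b3)"
  have zw: "(c1, c2, c3) = (a1, a2, a3) + z" "(d1, d2, d3) = (b1, b2, b3) + w"
    using le' by (simp_all add: z_def w_def)
  have "weight g (c1, c2, c3) = weight g (a1, a2, a3) + weight g z"
    "weight g (d1, d2, d3) = weight g (b1, b2, b3) + weight g w"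
    by (simp_all only: zw weight_add)
  then have "weight g z = weight g w"
    using qA pA by (simp add: ascents_def qq pp del: weight.simps)
  moreover have "len z \<le> len w"
    using qA pA le' unfolding ascents_def qq pp z_def w_def by simp linarith
  ultimately have "(z, w) \<in> ascents g" by (simp add: ascents_def)
  moreover have pq: "p = q + (z, w)" by (simp only: qq pp zw add_Pair)
  moreover have "(z, w) \<noteq> 0" using ne pq by auto
  ultimately show False using p q(2) qA unfolding irreducible_ascents_def by blast
qed

lemma linked_up_translate: "linked_up g N z w \<Longrightarrow> linked_up g N (z + c) (w + c)"
  by (simp add: linked_up_def linked_def fdist_translate weight_add len_add)

lemma linked_up_rtranclp_translate:
  "(linked_up g N)\<^sup>*\<^sup>* z w \<Longrightarrow> (linked_up g N)\<^sup>*\<^sup>* (z + c) (w + c)"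
  by (induction rule: rtranclp_induct) (auto intro: rtranclp.rtrancl_into_rtrancl linked_up_translate)

text \<open>Splitting an ascent as \<open>(a, b) + (c, d)\<close>, the path \<open>a + c \<rightarrow> b + c \<rightarrow> b + d\<close> goes up in length
  twice. Irreducible ascents are single steps, and there are finitely many of them.\<close>

lemma ascents_linked_up:
  "\<exists>N. \<forall>(z, w) \<in> ascents g. (linked_up g N)\<^sup>*\<^sup>* z w"
proof -
  obtain N where N: "\<And>z w. (z, w) \<in> irreducible_ascents g \<Longrightarrow> len w \<le> N"
    using finite_nat_set_iff_bounded_le[of "(\<lambda>(z, w). len w) ` irreducible_ascents g"]
      finite_irreducible_ascents[of g] by fastforce
  have "(linked_up g N)\<^sup>*\<^sup>* z w" if "(z, w) \<in> ascents g" for z w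
    using that
  proof (induction "len z + len w" arbitrary: z w rule: less_induct)
    case less
    show ?case
    proof (cases "(z, w) \<in> irreducible_ascents g")
      case True
      have "fdist z w \<le> N"
        using fdist_le_len[of z w] N[OF True] less.prems by (simp add: ascents_def)
      with less.prems have "linked_up g N z w"
        by (simp add: ascents_def linked_up_def linked_def)
      then show ?thesis by blast
    next
      case False
      then obtain q r where qr: "q \<in> ascents g" "r \<in> ascents g" "q \<noteq> 0" "r \<noteq> 0" "(z, w) = q + r"
        using less.prems unfolding irreducible_ascents_def by blast
      obtain a b c d where ab: "q = (a, b)" and cd: "r = (c, d)" by (metis prod.exhaust)
      have zw: "z = a + c" "w = b + d" using qr(5) ab cd by simp_all
      have "len a + len b > 0" "len c + len d > 0"
        using qr(3,4) len_eq_0_iff[of a] len_eq_0_iff[of b] len_eq_0_iff[of c] len_eq_0_iff[of d] by (auto simp: ab cd zero_prod_def simp del: len.simps)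
      then have "(linked_up g N)\<^sup>*\<^sup>* a b" "(linked_up g N)\<^sup>*\<^sup>* c d"
        using less.hyps[of a b] less.hyps[of c d] qr(1,2) by (simp_all add: zw ab cd len_add)
      then have "(linked_up g N)\<^sup>*\<^sup>* (a + c) (b + c)" "(linked_up g N)\<^sup>*\<^sup>* (c + b) (d + b)"
        using linked_up_rtranclp_translate by blast+
      then show ?thesis by (metis zw add.commute rtranclp_trans)
    qed
  qed
  then show ?thesis by blast
qed

lemma monotone_chains_bounded:
  "\<exists>N. \<forall>m. \<forall>z\<in>factorizations g m. \<forall>w\<in>factorizations g m. \<exists>zs. is_monotone_chain g m N z w zs"
proof -
  obtain N where N: "\<And>z w. (z, w) \<in> ascents g \<Longrightarrow> (linked_up g N)\<^sup>*\<^sup>* z w"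
    using ascents_linked_up by blast
  have up: "\<exists>zs. is_chain g m N z w zs \<and> sorted_wrt (\<le>) (map len zs)"
    if "z \<in> factorizations g m" "w \<in> factorizations g m" "len z \<le> len w" for m z w
    using monotone_chain_of_linked_up[OF N that(1), of w] that
    by (simp add: ascents_def factorizations_def)
  have "\<exists>zs. is_monotone_chain g m N z w zs"
    if z: "z \<in> factorizations g m" and w: "w \<in> factorizations g m" for m z w
  proof (cases "len z \<le> len w")
    case True
    then show ?thesis using up[OF z w] by (auto simp: is_monotone_chain_def)
  next
    case False
    then obtain zs where "is_chain g m N w z zs" "sorted_wrt (\<le>) (map len zs)"
      using up[OF w z] by auto
    then have "is_monotone_chain g m N z w (rev zs)"
      by (simp add: is_monotone_chain_def is_chain_rev rev_map[symmetric] sorted_wrt_rev)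
    then show ?thesis by blast
  qed
  then show ?thesis by blast
qed

text \<open>The uniform bound makes the set under the maximum finite; the maximum of an infinite set would
  be an arbitrary number.\<close>

lemma monotone_catenary_degree_of_le:
  assumes "m \<in> generated (gens g)"
  shows "monotone_catenary_degree_of g m \<le> monotone_catenary_degree g"
proof -
  obtain N where N: "\<And>m. \<forall>z\<in>factorizations g m. \<forall>w\<in>factorizations g m.
      \<exists>zs. is_monotone_chain g m N z w zs"
    using monotone_chains_bounded by blast
  have "monotone_catenary_degree_of g m \<le> N" for m
    unfolding monotone_catenary_degree_of_def using N by (rule Least_le)
  then have "finite {monotone_catenary_degree_of g m | m. m \<in> generated (gens g)}"
    by (auto simp: finite_nat_set_iff_bounded_le)
  then show ?thesis using assms unfolding monotone_catenary_degree_def by (auto intro!: Max_ge)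
qed

lemma monotone_catenary_degree_of_chain:
  assumes "z \<in> factorizations g m" "w \<in> factorizations g m"
  shows "\<exists>zs. is_monotone_chain g m (monotone_catenary_degree_of g m) z w zs"
proof -
  have "\<exists>N. \<forall>z\<in>factorizations g m. \<forall>w\<in>factorizations g m. \<exists>zs. is_monotone_chain g m N z w zs"
    using monotone_chains_bounded by blast
  from LeastI_ex[OF this] show ?thesis using assms unfolding monotone_catenary_degree_of_def by blast
qed

section \<open>Criteria for bounding the two catenary degrees\<close>

lemma submonoid_generated: "submonoid (generated A)"
  by (auto simp: generated_def submonoid_def hull_def)

lemma multiple_in_generated:
  assumes "u \<in> A"
  shows "k * u \<in> generated A"
proof (induction k)
  case 0
  show ?case using submonoid_generated[of A] by (simp add: submonoid_def)
next
  case (Suc k)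
  have "u \<in> generated A" using assms by (simp add: generated_def hull_inc)
  with Suc show ?case using submonoid_generated[of A] by (simp add: submonoid_def)
qed

lemma catenary_degree_leI:
  assumes "\<And>z w. weight g z = weight g w \<Longrightarrow> (linked g N)\<^sup>*\<^sup>* z w"
  shows "catenary_degree g \<le> N"
proof -
  have le: "catenary_degree_of g m \<le> N" for m
    unfolding catenary_degree_of_def
  proof (rule Least_le, intro ballI)
    fix z w assume "z \<in> factorizations g m" "w \<in> factorizations g m"
    then show "\<exists>zs. is_chain g m N z w zs"
      using chain_of_linked assms by (metis (mono_tags) factorizations_def mem_Collect_eq)
  qed
  have "0 \<in> generated (gens g)" using submonoid_generated by (simp add: submonoid_def)
  then have "{catenary_degree_of g m | m. m \<in> generated (gens g)} \<noteq> {}" by blast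
  moreover have "finite {catenary_degree_of g m | m. m \<in> generated (gens g)}"
    using le by (auto simp: finite_nat_set_iff_bounded_le)
  ultimately show ?thesis unfolding catenary_degree_def using le by (auto simp: Max_le_iff)
qed

lemma sorted_wrt_hd_last:
  assumes "sorted_wrt P xs" "u \<in> set xs" "\<And>v. P v v"
  shows "P (hd xs) u \<and> P u (last xs)"
  using assms(1,2)
proof (induction xs)
  case (Cons y ys)
  then show ?case using assms(3) last_in_set[of ys] by (cases "ys = []") auto
qed simp

text \<open>All members of a monotone chain whose ends have the same length have that length, and the
  chain has a step between two distinct members because its ends are distinct.\<close>

lemma monotone_catenary_degree_geI:
  assumes "weight g z = weight g w" "len z = len w" "z \<noteq> w"
    and m: "weight g z \<in> generated (gens g)"
    and far: "\<And>u v. weight g u = weight g v \<Longrightarrow> len u = len v \<Longrightarrow> u \<noteq> v \<Longrightarrow> B \<le> fdist u v"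
  shows "B \<le> monotone_catenary_degree g"
proof -
  let ?m = "weight g z" and ?N = "monotone_catenary_degree_of g (weight g z)"
  have "B \<le> ?N"
  proof (rule ccontr)
    assume "\<not> B \<le> ?N"
    obtain zs where "is_monotone_chain g ?m ?N z w zs"
      using monotone_catenary_degree_of_chain[of z g ?m w] assms(1) by (auto simp: factorizations_def)
    then have zs: "zs \<noteq> []" "hd zs = z" "last zs = w" "set zs \<subseteq> factorizations g ?m"
      "successively (\<lambda>u v. fdist u v \<le> ?N) zs"
      and mono: "sorted_wrt (\<le>) (map len zs) \<or> sorted_wrt (\<ge>) (map len zs)"
      by (auto simp: is_monotone_chain_def is_chain_def)
    have len: "len u = len z" if "u \<in> set zs" for u
    proof -
      have "u \<in> set zs \<Longrightarrow> len (hd zs) \<le> len u \<and> len u \<le> len (last zs) \<or>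
          len (hd zs) \<ge> len u \<and> len u \<ge> len (last zs)"
        using mono sorted_wrt_hd_last[of "\<lambda>v w. len v \<le> len w" zs u]
          sorted_wrt_hd_last[of "\<lambda>v w. len v \<ge> len w" zs u] by (auto simp: sorted_wrt_map)
      then show ?thesis using that zs(2,3) assms(2) by auto
    qed
    have "successively (=) zs"
      using zs(5)
    proof (rule successively_mono)
      fix u v assume uv: "u \<in> set zs" "v \<in> set zs" "fdist u v \<le> ?N"
      then have "u \<in> factorizations g ?m" "v \<in> factorizations g ?m" using zs(4) by blast+
      then have "weight g u = weight g v" by (simp add: factorizations_def)
      then show "u = v" using far[of u v] len[OF uv(1)] len[OF uv(2)] uv(3) \<open>\<not> B \<le> ?N\<close> by linarith
    qed
    moreover have "successively (=) xs \<Longrightarrow> xs \<noteq> [] \<Longrightarrow> hd xs = last xs" for xs :: "triple list"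
      by (induction xs rule: induct_list012) auto
    ultimately show False using zs assms(3) by metis
  qed
  then show ?thesis using monotone_catenary_degree_of_le[OF m] by linarith
qed

section \<open>Relations between the generators \<open>n a\<close>, \<open>n a + n\<close>, \<open>2 n a + n x + 1\<close>\<close>

locale arithmetic_triple =
  fixes n a x :: nat
  assumes n: "n > 0" and a: "a > 0" and x: "x \<ge> 2"
begin

abbreviation g :: triple where
  "g \<equiv> (n * a, n * a + n, 2 * n * a + n * x + 1)"

text \<open>\<open>(p, - q, n)\<close> is the relation with third coordinate \<open>n\<close> and coordinate sum \<open>- n\<close>; adding
  multiples of \<open>(a + 1, - a, 0)\<close> gives the others with third coordinate \<open>n\<close>.\<close>

definition p :: int where "p = int n * int x + 1 - 2 * int n"
definition q :: int where "q = int n * int x + 1"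

text \<open>Modulo \<open>n\<close> only the third generator survives, and it is \<open>1\<close>; so the third coordinates differ
  by some \<open>t n\<close>. After cancelling \<open>n\<close>, the sum of the first two differences determines the rest.\<close>

lemma weight_eq_iff:
  "weight g (z1, z2, z3) = weight g (w1, w2, w3) \<longleftrightarrow>
    (\<exists>t k. int z1 = int w1 + t * p + k * (int a + 1) \<and>
           int z2 = int w2 - t * q - k * int a \<and>
           int z3 = int w3 + t * int n)" (is "?l \<longleftrightarrow> ?r")
proof
  define u1 u2 u3 where u: "u1 = int z1 - int w1" "u2 = int z2 - int w2" "u3 = int z3 - int w3"
  assume ?l
  then have "int (weight g (z1, z2, z3)) = int (weight g (w1, w2, w3))" by simp
  then have e: "u3 = - int n * (int a * u1 + (int a + 1) * u2 + (2 * int a + int x) * u3)"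
    by (simp add: u algebra_simps)
  then obtain t where t: "u3 = int n * t" by (metis mult.assoc mult_minus_left mult_minus_right)
  have "int n * (t + (int a * u1 + (int a + 1) * u2 + (2 * int a + int x) * (int n * t))) = 0"
    using e unfolding t by (simp add: algebra_simps)
  then have e2: "t + (int a * u1 + (int a + 1) * u2 + (2 * int a + int x) * (int n * t)) = 0"
    using n by simp
  define k where "k = u1 + u2 + 2 * int n * t"
  have "u2 = - t * q - k * int a" using e2 by (simp add: k_def q_def algebra_simps)
  moreover from this have "u1 = t * p + k * (int a + 1)" by (simp add: k_def p_def q_def algebra_simps)
  ultimately show ?r using t u by (intro exI[of _ t] exI[of _ k]) (simp add: algebra_simps)
next
  assume ?r
  then obtain t k where e: "int z1 = int w1 + t * p + k * (int a + 1)"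
    "int z2 = int w2 - t * q - k * int a" "int z3 = int w3 + t * int n" by blast
  have "int (weight g (z1, z2, z3)) = int (weight g (w1, w2, w3))"
    by (simp add: e p_def q_def algebra_simps)
  then show ?l by (simp only: of_nat_eq_iff)
qed

section \<open>Monotone chains need a long step\<close>

text \<open>The length changes by \<open>k - t n\<close>, so \<open>k = t n\<close>, and the second coordinate then changes by
  \<open>- t (q + n a)\<close>.\<close>

lemma fdist_same_length:
  assumes "weight g u = weight g v" "len u = len v" "u \<noteq> v"
  shows "n * a + n * x + 1 \<le> fdist u v"
proof -
  obtain u1 u2 u3 v1 v2 v3 where uv: "u = (u1, u2, u3)" "v = (v1, v2, v3)" by (metis prod.exhaust)
  obtain t k where e: "int u1 = int v1 + t * p + k * (int a + 1)"
    "int u2 = int v2 - t * q - k * int a" "int u3 = int v3 + t * int n"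
    using assms(1) unfolding uv weight_eq_iff by blast
  have "int u1 + int u2 + int u3 = int v1 + int v2 + int v3"
    using assms(2) uv by (simp flip: of_nat_add)
  then have k: "k = t * int n" using e by (simp add: p_def q_def algebra_simps)
  define D where "D = int (n * a + n * x + 1)"
  have d: "int u2 = int v2 - t * D" using e(2) by (simp add: k D_def q_def algebra_simps)
  have "t \<noteq> 0" using assms(3) e k by (auto simp: uv)
  then have "1 \<le> \<bar>t\<bar>" by linarith
  then have "1 * D \<le> \<bar>t\<bar> * D" by (intro mult_right_mono) (auto simp: D_def)
  also have "\<dots> = \<bar>t * D\<bar>" by (simp add: abs_mult D_def)
  finally have "D \<le> \<bar>int u2 - int v2\<bar>" using d by simp
  then have "n * a + n * x + 1 \<le> max (u2 - v2) (v2 - u2)" unfolding D_def by linarith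
  also have "\<dots> \<le> fdist u v" unfolding uv fdist_eq by linarith
  finally show ?thesis .
qed

lemma monotone_catenary_degree_lower: "n * a + n * x + 1 \<le> monotone_catenary_degree g"
proof (rule monotone_catenary_degree_geI)
  define B where "B = n * a + n * x + 1"
  have nx: "2 * n \<le> n * x" using x by simp
  let ?z = "(B - n, 0, n) :: triple" and ?w = "(0, B, 0) :: triple"
  have nB: "n \<le> B" using nx unfolding B_def by linarith
  show w: "weight g ?w = weight g ?z"
    unfolding weight_eq_iff
    \<comment> \<open>The difference is the negative of the relation with \<open>t = 1\<close>, \<open>k = n\<close>.\<close>
    by (rule exI[of _ "-1"], rule exI[of _ "- int n"]) (use nB in \<open>simp add: B_def p_def q_def of_nat_diff algebra_simps\<close>)
  show "len ?w = len ?z" using nB by simp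
  show "?w \<noteq> ?z" using n by simp
  show "weight g ?w \<in> generated (gens g)"
    using multiple_in_generated[of "n * a + n" "gens g" B] by simp
qed (rule fdist_same_length)

section \<open>Unrestricted chains can avoid long steps\<close>

abbreviation K :: nat where "K \<equiv> n * a + n * x"

lemma bounds: "2 * n \<le> n * x" "a \<le> n * a" "p \<ge> 1" "q \<le> int K" "q = p + 2 * int n"
proof -
  show 1: "2 * n \<le> n * x" using x by simp
  show 2: "a \<le> n * a" using n by simp
  have "int (2 * n) \<le> int (n * x)" using 1 by (simp only: of_nat_le_iff)
  then show "p \<ge> 1" by (simp add: p_def)
  have "1 \<le> n * a" using n a by (simp add: Suc_le_eq)
  then have "n * x + 1 \<le> K" by linarith
  then have "int (n * x + 1) \<le> int K" by (simp only: of_nat_le_iff)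
  then show "q \<le> int K" by (simp add: q_def)
qed (simp add: p_def q_def)

text \<open>The bound on \<open>i (a + 1)\<close> says that the first coordinate drops by at most \<open>a\<close>. As \<open>p \<ge> 1\<close>, it also
  forces \<open>i \<le> p\<close>, which controls the one case where both of the first two coordinates drop: the
  step then has size \<open>2 n + i \<le> q\<close>.\<close>

lemma linked_step:
  assumes "0 \<le> i" "i * (int a + 1) \<le> p + int a"
    and "int v1 = int u1 + p - i * (int a + 1)" "int v2 = int u2 - q + i * int a" "v3 = u3 + n"
  shows "linked g K (u1, u2, u3) (v1, v2, v3)"
proof -
  have w: "weight g (v1, v2, v3) = weight g (u1, u2, u3)"
    unfolding weight_eq_iff using assms(3-5)
    by (intro exI[of _ 1] exI[of _ "-i"]) (simp add: algebra_simps)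
  have i: "i \<le> p"
  proof (rule ccontr)
    assume "\<not> i \<le> p"
    then have "(p + 1) * (int a + 1) \<le> i * (int a + 1)" by (intro mult_right_mono) auto
    moreover have "(p + 1) * (int a + 1) = p * int a + p + int a + 1" by (simp add: algebra_simps)
    moreover have "p * int a \<ge> 0" using bounds(3) by (intro mult_nonneg_nonneg) auto
    ultimately show False using assms(2) by linarith
  qed
  define I k where "I = i * int a" and "k = K"
  have "i * (int a + 1) = I + i" by (simp add: I_def algebra_simps)
  then have A: "int v1 = int u1 + p - (I + i)" "int v2 = int u2 - q + I" "I + i \<le> p + int a" "0 \<le> I"
    using assms by (simp_all add: I_def)
  have k: "a \<le> k" "n \<le> k" "q \<le> int k" unfolding k_def using bounds by linarith+
  have "(u1 - v1) + (u2 - v2) \<le> k" using A k i assms(1) bounds(5) by linarith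
  moreover have "(v1 - u1) + (v2 - u2) + n \<le> k" using A k i assms(1) bounds(3,5) by linarith
  ultimately have "fdist (u1, u2, u3) (v1, v2, v3) \<le> K"
    unfolding fdist_eq k_def assms(5) by simp
  with w show ?thesis by (simp add: linked_def)
qed

lemma linked_base_step: "linked g K (z1 + (a + 1), z2, z3) (z1, z2 + a, z3)"
proof -
  have "weight g (z1 + (a + 1), z2, z3) = weight g (z1, z2 + a, z3)" by (simp add: algebra_simps)
  moreover have "a + 1 \<le> K" using bounds(1,2) n by linarith
  ultimately show ?thesis by (simp add: linked_def fdist_eq)
qed

lemma linked_reduced:
  "\<exists>z1' z2'. (linked g K)\<^sup>*\<^sup>* (z1, z2, z3) (z1', z2', z3) \<and> z1' \<le> a"
proof (induction z1 arbitrary: z2 rule: less_induct)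
  case (less z1)
  show ?case
  proof (cases "z1 \<le> a")
    case False
    define y where "y = z1 - (a + 1)"
    have y: "z1 = y + (a + 1)" using False by (simp add: y_def)
    then have "y < z1" by simp
    then obtain z1' z2' where
      "(linked g K)\<^sup>*\<^sup>* (y, z2 + a, z3) (z1', z2', z3)" "z1' \<le> a" using less[of y "z2 + a"] by blast
    then show ?thesis
      using converse_rtranclp_into_rtranclp[of "linked g K", OF linked_base_step[of y z2 z3]] y by blast
  next
    case True
    then show ?thesis by blast
  qed
qed

lemma linked_rtranclp_sym: "(linked g N)\<^sup>*\<^sup>* z w \<Longrightarrow> (linked g N)\<^sup>*\<^sup>* w z"
  using linked_commute by (metis sympI sympD symp_rtranclp)

lemma weight_linked_rtranclp: "(linked g N)\<^sup>*\<^sup>* z w \<Longrightarrow> weight g z = weight g w"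
  by (induction rule: rtranclp_induct) (auto simp: linked_def)

lemma step_down:
  assumes "n \<le> z3" "p \<le> int z1 + i * (int a + 1)" "i * int a \<le> int z2 + q" "0 \<le> i"
    "i * (int a + 1) \<le> p + int a"
  shows "\<exists>y1 y2. linked g K (z1, z2, z3) (y1, y2, z3 - n)"
proof -
  have "linked g K (nat (int z1 - p + i * (int a + 1)), nat (int z2 + q - i * int a), z3 - n) (z1, z2, z3)"
    using assms by (intro linked_step[of i]) auto
  then show ?thesis using linked_commute by blast
qed

text \<open>For a factorization with first coordinate at most \<open>a\<close>, every upward step that keeps this
  coordinate nonnegative is short.\<close>

lemma step_up:
  assumes "z1 \<le> a" "i * (int a + 1) \<le> int z1 + p" "q \<le> int z2 + i * int a" "0 \<le> i"
  shows "\<exists>y1 y2. linked g K (z1, z2, z3) (y1, y2, z3 + n)"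
proof -
  have "linked g K (z1, z2, z3) (nat (int z1 + p - i * (int a + 1)), nat (int z2 - q + i * int a), z3 + n)"
    using assms by (intro linked_step[of i]) auto
  then show ?thesis by blast
qed

text \<open>In this situation \<open>w\<^sub>1 + w\<^sub>2 < a + i + 2 n\<close>, which is within \<open>K\<close> because \<open>i\<close> is at most
  \<open>p = n (x - 2) + 1\<close>. Moreover \<open>w\<close> is the longer factorization: \<open>z\<^sub>1 < p \<le> t p\<close> forces the
  multiplicity \<open>k\<close> of the short relation to be negative. As \<open>w\<^sub>3 < z\<^sub>3\<close>, the distance is at most
  \<open>w\<^sub>1 + w\<^sub>2\<close>.\<close>

lemma linked_stuck:
  assumes w: "weight g (z1, z2, z3) = weight g (w1, w2, w3)" and "w3 < z3" and "0 \<le> i"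
    and z: "int z1 + i * (int a + 1) < p" "int z2 + q < (i + 1) * int a"
    and w': "int w1 + p < (i + 1) * (int a + 1)" "int w2 + i * int a < q"
  shows "linked g K (z1, z2, z3) (w1, w2, w3)"
proof -
  obtain t k where e: "int z1 = int w1 + t * p + k * (int a + 1)"
    "int z2 = int w2 - t * q - k * int a" "int z3 = int w3 + t * int n"
    using w unfolding weight_eq_iff by blast
  have "t * int n > 0" using e(3) \<open>w3 < z3\<close> by linarith
  then have t: "t \<ge> 1" using n by (simp add: zero_less_mult_iff)
  have "k < 0"
  proof (rule ccontr)
    assume "\<not> k < 0"
    then have "0 \<le> k * (int a + 1)" by simp
    moreover have "1 * p \<le> t * p" using t bounds(3) by (intro mult_right_mono) auto
    moreover have "0 \<le> i * (int a + 1)" using \<open>0 \<le> i\<close> by simp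
    ultimately show False using e(1) z(1) by linarith
  qed
  have "int w1 + int w2 + int w3 = int z1 + int z2 + int z3 + t * int n - k"
    using e by (simp add: bounds(5) algebra_simps)
  then have len: "z1 + z2 + z3 \<le> w1 + w2 + w3" using \<open>k < 0\<close> \<open>t * int n > 0\<close> by linarith
  have i: "i \<le> int n * (int x - 2) + 1"
  proof (rule ccontr)
    assume "\<not> ?thesis"
    then have "p + 1 \<le> i" by (simp add: p_def algebra_simps)
    moreover have "i * 1 \<le> i * (int a + 1)" using \<open>0 \<le> i\<close> by (intro mult_left_mono) auto
    ultimately show False using z(1) by linarith
  qed
  have "int w1 + int w2 \<le> int a + i + 2 * int n - 1" using w' by (simp add: bounds(5) algebra_simps)
  also have "\<dots> \<le> int n * int a + int n * int x"
  proof -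
    have "int a \<le> int n * int a" using bounds(2) by (simp flip: of_nat_mult)
    moreover have "i \<le> int n * int x - 2 * int n + 1" using i by (simp add: algebra_simps)
    ultimately show ?thesis by linarith
  qed
  finally have "w1 + w2 \<le> K" by (simp flip: of_nat_mult of_nat_add)
  then have "fdist (z1, z2, z3) (w1, w2, w3) \<le> K"
    using len \<open>w3 < z3\<close> unfolding fdist_eq by linarith
  with w show ?thesis by (simp add: linked_def)
qed

lemma div_bounds_int:
  fixes u d :: int
  assumes "0 < d"
  shows "u div d * d \<le> u" "u < u div d * d + d"
  using div_mult_mod_eq[of u d] pos_mod_bound[OF assms, of u] pos_mod_sign[OF assms, of u] by linarith+

text \<open>To raise the third coordinate of \<open>w\<close> the best choice is the largest \<open>i\<close> that keeps the first
  coordinate nonnegative; to lower that of \<open>z\<close> it is the smallest \<open>j\<close> with this property. If the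
  second coordinate rules out both, then \<open>j = i + 1\<close>.\<close>

lemma steps_or_stuck:
  fixes w1 w2 z1 z2 :: nat
  obtains
    (up) i where "i * (int a + 1) \<le> int w1 + p" "q \<le> int w2 + i * int a" "0 \<le> i"
  | (down) j where "p \<le> int z1 + j * (int a + 1)" "j * int a \<le> int z2 + q" "0 \<le> j"
      "j * (int a + 1) \<le> p + int a"
  | (stuck) i where "0 \<le> i" "int z1 + i * (int a + 1) < p" "int z2 + q < (i + 1) * int a"
      "int w1 + p < (i + 1) * (int a + 1)" "int w2 + i * int a < q"
proof -
  \<comment> \<open>\<open>j0\<close> is \<open>(p - z1) / (a + 1)\<close> rounded up.\<close>
  define i j0 j where "i = (int w1 + p) div (int a + 1)"
    and "j0 = (p - int z1 + int a) div (int a + 1)" and "j = max 0 j0"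
  have i0: "0 \<le> i" using bounds(3) by (simp add: i_def pos_imp_zdiv_nonneg_iff)
  have i: "i * (int a + 1) \<le> int w1 + p" "int w1 + p < (i + 1) * (int a + 1)"
    using div_bounds_int[of "int a + 1" "int w1 + p"] by (simp_all add: i_def algebra_simps)
  have j0: "j0 * (int a + 1) \<le> p - int z1 + int a" "p - int z1 \<le> j0 * (int a + 1)"
    using div_bounds_int[of "int a + 1" "p - int z1 + int a"] by (simp_all add: j0_def)
  have "j0 * (int a + 1) \<le> j * (int a + 1)" by (intro mult_right_mono) (auto simp: j_def)
  then have j1: "p \<le> int z1 + j * (int a + 1)" using j0(2) by linarith
  have j2: "j = 0 \<or> j * (int a + 1) \<le> p - int z1 + int a" using j0(1) by (auto simp: j_def max_def)
  have j3: "0 \<le> j" by (simp add: j_def)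
  have j4: "j * (int a + 1) \<le> p + int a" using j2 bounds(3) by auto
  show thesis
  proof (cases "q \<le> int w2 + i * int a \<or> j * int a \<le> int z2 + q")
    case True
    then show thesis using up[OF i(1) _ i0] down[OF j1 _ j3 j4] by blast
  next
    case False
    have "0 < q" using bounds(3,5) by linarith
    then have "j \<noteq> 0" using False by auto
    then have j5: "(j - 1) * (int a + 1) < p - int z1" using j2 by (simp add: algebra_simps)
    have "i * int a < j * int a" using False by linarith
    then have "i < j" by (simp add: mult_less_cancel_right)
    have "(j - 1) * (int a + 1) < (i + 1) * (int a + 1)" using j5 i(2) by linarith
    then have "j - 1 < i + 1" by (simp add: mult_less_cancel_right)
    with \<open>i < j\<close> have "j = i + 1" by linarith
    then show thesis using stuck[OF i0] False i(2) j5 by simp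
  qed
qed

text \<open>Each step brings the third coordinates closer by \<open>n\<close>, and the first coordinate is reduced again
  afterwards. When the third coordinates agree, the factorizations differ by a multiple of
  \<open>(a + 1, - a, 0)\<close>, so reducedness makes them equal.\<close>

lemma linked_connected_reduced:
  assumes "weight g (z1, z2, z3) = weight g (w1, w2, w3)" "z1 \<le> a" "w1 \<le> a" "w3 \<le> z3"
  shows "(linked g K)\<^sup>*\<^sup>* (z1, z2, z3) (w1, w2, w3)"
  using assms
proof (induction "z3 - w3" arbitrary: z1 z2 z3 w1 w2 w3 rule: less_induct)
  case less
  obtain t k where e: "int z1 = int w1 + t * p + k * (int a + 1)"
    "int z2 = int w2 - t * q - k * int a" "int z3 = int w3 + t * int n"
    using less.prems(1) unfolding weight_eq_iff by blast
  show ?case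
  proof (cases "z3 = w3")
    case True
    then have t: "t = 0" using e(3) n by simp
    have "\<bar>k * (int a + 1)\<bar> < int a + 1" using e(1) less.prems(2,3) by (simp add: t)
    then have "\<bar>k\<bar> * (int a + 1) < 1 * (int a + 1)" by (simp add: abs_mult)
    then have "k = 0" unfolding mult_less_cancel_right by auto
    then show ?thesis using e t by simp
  next
    case False
    then have "w3 < z3" using less.prems(4) by simp
    then have "t * int n > 0" using e(3) by linarith
    then have "t \<ge> 1" using n by (simp add: zero_less_mult_iff)
    then have "1 * int n \<le> t * int n" by (intro mult_right_mono) auto
    then have gap: "w3 + n \<le> z3" using e(3) by linarith
    show ?thesis
    proof (cases rule: steps_or_stuck[of w1 w2 _ z1 z2])
      case (up i)
      then obtain y1 y2 where y: "linked g K (w1, w2, w3) (y1, y2, w3 + n)"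
        using step_up less.prems(3) by blast
      obtain v1 v2 where v: "(linked g K)\<^sup>*\<^sup>* (y1, y2, w3 + n) (v1, v2, w3 + n)" "v1 \<le> a"
        using linked_reduced by blast
      have wv: "(linked g K)\<^sup>*\<^sup>* (w1, w2, w3) (v1, v2, w3 + n)" using y v(1) by (rule converse_rtranclp_into_rtranclp)
      have "(linked g K)\<^sup>*\<^sup>* (z1, z2, z3) (v1, v2, w3 + n)"
        using less.hyps[of z3 "w3 + n" z1 z2 v1 v2] less.prems v(2) gap n weight_linked_rtranclp[OF wv] by simp
      then show ?thesis using linked_rtranclp_sym[OF wv] by (rule rtranclp_trans)
    next
      case (down j)
      then obtain y1 y2 where y: "linked g K (z1, z2, z3) (y1, y2, z3 - n)"
        using step_down[of z3 z1 j z2] gap by auto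
      obtain v1 v2 where v: "(linked g K)\<^sup>*\<^sup>* (y1, y2, z3 - n) (v1, v2, z3 - n)" "v1 \<le> a"
        using linked_reduced by blast
      have zv: "(linked g K)\<^sup>*\<^sup>* (z1, z2, z3) (v1, v2, z3 - n)" using y v(1) by (rule converse_rtranclp_into_rtranclp)
      have "(linked g K)\<^sup>*\<^sup>* (v1, v2, z3 - n) (w1, w2, w3)"
        using less.hyps[of "z3 - n" w3 v1 v2 w1 w2] less.prems v(2) gap n weight_linked_rtranclp[OF zv] by simp
      with zv show ?thesis by (rule rtranclp_trans)
    next
      case (stuck i)
      then show ?thesis using linked_stuck[OF less.prems(1) \<open>w3 < z3\<close>] by blast
    qed
  qed
qed

lemma linked_connected:
  assumes "weight g z = weight g w"
  shows "(linked g K)\<^sup>*\<^sup>* z w"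
proof -
  obtain z1 z2 z3 w1 w2 w3 where zw: "z = (z1, z2, z3)" "w = (w1, w2, w3)" by (metis prod.exhaust)
  obtain y1 y2 where y: "(linked g K)\<^sup>*\<^sup>* z (y1, y2, z3)" "y1 \<le> a" using linked_reduced zw by blast
  obtain v1 v2 where v: "(linked g K)\<^sup>*\<^sup>* w (v1, v2, w3)" "v1 \<le> a" using linked_reduced zw by blast
  have e: "weight g (y1, y2, z3) = weight g (v1, v2, w3)"
    using assms weight_linked_rtranclp[OF y(1)] weight_linked_rtranclp[OF v(1)] by simp
  have "(linked g K)\<^sup>*\<^sup>* (y1, y2, z3) (v1, v2, w3)"
  proof (cases "w3 \<le> z3")
    case True
    then show ?thesis using linked_connected_reduced[OF e] y v by blast
  next
    case False
    then show ?thesis using linked_connected_reduced[OF e[symmetric]] y v linked_rtranclp_sym by simp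
  qed
  then show ?thesis using y(1) linked_rtranclp_sym[OF v(1)] by (meson rtranclp_trans)
qed

end

theorem theorem11:
  fixes n a x :: nat
  assumes "n > 0" and "a > 0" and "x \<ge> 2"
    and "numerical_monoid (generated {n * a, n * a + n, 2 * n * a + n * x + 1})"
    and "embedding_dimension (generated {n * a, n * a + n, 2 * n * a + n * x + 1}) = 3"
  shows "monotone_catenary_degree (n * a, n * a + n, 2 * n * a + n * x + 1)
           > catenary_degree (n * a, n * a + n, 2 * n * a + n * x + 1)"
proof -
  interpret arithmetic_triple n a x by standard (use assms in auto)
  have "catenary_degree g \<le> K" using linked_connected by (rule catenary_degree_leI)
  then show ?thesis using monotone_catenary_degree_lower by linarith
qed

end
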